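(* Under the independent cascade model with myopic feedback, the adaptivity gap of the influence maximization problem is at most $4$; that is, $$\sup_{G,k}\frac{\mathrm{OPT}_A(G,k)}{\mathrm{OPT}_N(G,k)}\le 4,$$ where the supremum is over all influence graphs $G$ and all seed budgets $k\ge 1$.
   Context: Influence graph: $G=(V,E,p)$, where $V$ is a finite nonempty set of nodes, $E\subseteq V\times V$ is a set of directed edges, and each edge $(u,v)\in E$ carries a probability $p_{uv}\in[0,1]$. Independent cascade (IC) model: a random live-edge graph is obtained by declaring each edge $(u,v)\in E$ live independently with probability $p_{uv}$, and blocked otherwise. A realization $\phi$ specifies the status (live or blocked) of every edge; it is identified with the corresponding live-edge graph. $\mathcal P$ denotes the distribution of the random realization $\Phi$. For $S\subseteq V$, $\Gamma(S,\phi)$ is the set of nodes reachable in $\phi$ from nodes of $S$ (including $S$ itself), $f(S,\phi)=|\Gamma(S,\phi)|$, and $\sigma(S)=\mathbb E_{\Phi\sim\mathcal P}[f(S,\Phi)]$ is the influence spread of $S$. Myopic feedback: when $u$ is selected as a seed under realization $\phi$, the feedback $\phi(u)$ revealed is the live/blocked status of the out-going edges of $u$, and nothing else. A partial realization $\psi$ assigns to each node of a set $\mathrm{dom}(\psi)\subseteq V$ a status of its out-going edges. A (deterministic) adaptive policy $\pi$ selects seeds one by one: starting from the empty partial realization, when the current partial realization is $\psi$ it either stops or selects a node $\pi(\psi)\notin\mathrm{dom}(\psi)$, and the pair $(\pi(\psi),\phi(\pi(\psi)))$ is then added to $\psi$. $V(\pi,\phi)$ is the set of nodes selected by $\pi$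 under realization $\phi$. $\Pi(k)$ is the set of policies with $|V(\pi,\phi)|\le k$ for all $\phi$. The adaptive influence spread is $\sigma(\pi)=\mathbb E_{\Phi\sim\mathcal P}[f(V(\pi,\Phi),\Phi)]$. $\mathrm{OPT}_N(G,k)=\max_{S\subseteq V,\,|S|\le k}\sigma(S)$ and $\mathrm{OPT}_A(G,k)=\max_{\pi\in\Pi(k)}\sigma(\pi)$. *)

theory Defs
  imports "HOL-Probability.Probability" "HOL-Library.Extended_Real"
begin

record 'v influence_graph =
  nodes :: "'v set"
  edges :: "('v \<times> 'v) set"
  prob :: "'v \<times> 'v \<Rightarrow> real"

locale influence_graph =
  fixes G :: "'v influence_graph"
  assumes finite_nodes: "finite (nodes G)"
    and nodes_nonempty: "nodes G \<noteq> {}"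
    and edges_subset: "edges G \<subseteq> nodes G \<times> nodes G"
    and prob_range: "e \<in> edges G \<Longrightarrow> prob G e \<in> {0..1}"


subsection \<open>Independent cascade model\<close>

text \<open>
  A realization maps an edge to \<^const>\<open>True\<close> if it is live and to \<^const>\<open>False\<close> if it is blocked.
  Only its values on the edges of the graph matter; everything below ignores the other values.
\<close>

type_synonym 'v realization = "'v \<times> 'v \<Rightarrow> bool"

definition realization_pmf :: "'v influence_graph \<Rightarrow> 'v realization pmf" where
  "realization_pmf G = Pi_pmf (edges G) False (\<lambda>e. bernoulli_pmf (prob G e))"

definition live_edges :: "'v influence_graph \<Rightarrow> 'v realization \<Rightarrow> ('v \<times> 'v) set" where
  "live_edges G \<phi> = {e \<in> edges G. \<phi> e}"

definition reachable :: "'v influence_graph \<Rightarrow> 'v set \<Rightarrow> 'v realization \<Rightarrow> 'v set" where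
  "reachable G S \<phi> = (live_edges G \<phi>)\<^sup>* `` S"

definition spread :: "'v influence_graph \<Rightarrow> 'v set \<Rightarrow> 'v realization \<Rightarrow> nat" where
  "spread G S \<phi> = card (reachable G S \<phi>)"

definition influence_spread :: "'v influence_graph \<Rightarrow> 'v set \<Rightarrow> real" where
  "influence_spread G S = measure_pmf.expectation (realization_pmf G) (\<lambda>\<phi>. real (spread G S \<phi>))"


subsection \<open>Adaptive policies with myopic feedback\<close>

text \<open>
  The status of the out-going edges of a node is encoded as the set of heads of its live
  out-going edges; all its other out-going edges are blocked.
\<close>

type_synonym 'v partial_realization = "'v \<rightharpoonup> 'v set"

definition feedback :: "'v influence_graph \<Rightarrow> 'v realization \<Rightarrow> 'v \<Rightarrow> 'v set" where
  "feedback G \<phi> u = {v. (u, v) \<in> edges G \<and> \<phi> (u, v)}"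

definition partial_realizations :: "'v influence_graph \<Rightarrow> 'v partial_realization set" where
  "partial_realizations G =
    {\<psi>. dom \<psi> \<subseteq> nodes G \<and> (\<forall>u\<in>dom \<psi>. the (\<psi> u) \<subseteq> {v. (u, v) \<in> edges G})}"

text \<open>A policy returns \<^const>\<open>None\<close> to stop and \<open>Some u\<close> to select \<open>u\<close> as the next seed.\<close>

type_synonym 'v policy = "'v partial_realization \<Rightarrow> 'v option"

definition policies :: "'v influence_graph \<Rightarrow> 'v policy set" where
  "policies G =
    {\<pi>. \<forall>\<psi>\<in>partial_realizations G. \<forall>u. \<pi> \<psi> = Some u \<longrightarrow> u \<in> nodes G - dom \<psi>}"

text \<open>The partial realizations met while running a policy under a fixed realization.\<close>

inductive observes ::
  "'v influence_graph \<Rightarrow> 'v policy \<Rightarrow> 'v realization \<Rightarrow> 'v partial_realization \<Rightarrow> bool"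
  for G \<pi> \<phi> where
  start: "observes G \<pi> \<phi> Map.empty"
| select: "observes G \<pi> \<phi> \<psi> \<Longrightarrow> \<pi> \<psi> = Some u \<Longrightarrow> observes G \<pi> \<phi> (\<psi>(u \<mapsto> feedback G \<phi> u))"

definition selected :: "'v influence_graph \<Rightarrow> 'v policy \<Rightarrow> 'v realization \<Rightarrow> 'v set" where
  "selected G \<pi> \<phi> = {u. \<exists>\<psi>. observes G \<pi> \<phi> \<psi> \<and> \<pi> \<psi> = Some u}"

definition budget_policies :: "'v influence_graph \<Rightarrow> nat \<Rightarrow> 'v policy set" where
  "budget_policies G k = {\<pi> \<in> policies G. \<forall>\<phi>. card (selected G \<pi> \<phi>) \<le> k}"

definition adaptive_spread :: "'v influence_graph \<Rightarrow> 'v policy \<Rightarrow> real" where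
  "adaptive_spread G \<pi> =
    measure_pmf.expectation (realization_pmf G) (\<lambda>\<phi>. real (spread G (selected G \<pi> \<phi>) \<phi>))"


subsection \<open>Optimal values\<close>

definition OPT_N :: "'v influence_graph \<Rightarrow> nat \<Rightarrow> real" where
  "OPT_N G k = Max (influence_spread G ` {S. S \<subseteq> nodes G \<and> card S \<le> k})"

definition OPT_A :: "'v influence_graph \<Rightarrow> nat \<Rightarrow> real" where
  "OPT_A G k = Max (adaptive_spread G ` budget_policies G k)"

text \<open>
  Different policies have only finitely many different spreads, so both maxima are attained, and
  the non-adaptive one is positive.
\<close>

context influence_graph
begin

lemma finite_edges: "finite (edges G)"
  using finite_nodes edges_subset by (meson finite_SigmaI finite_subset)

lemma finite_realizations: "finite (set_pmf (realization_pmf G))"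
proof (rule finite_subset)
  show "set_pmf (realization_pmf G) \<subseteq> (\<lambda>L e. e \<in> L) ` Pow (edges G)"
  proof
    fix \<phi> assume "\<phi> \<in> set_pmf (realization_pmf G)"
    then have "\<And>e. e \<notin> edges G \<Longrightarrow> \<phi> e = False"
      using set_Pi_pmf_subset[OF finite_edges] unfolding realization_pmf_def by fastforce
    then have "\<phi> = (\<lambda>e. e \<in> {e \<in> edges G. \<phi> e})" by (intro ext) blast
    then show "\<phi> \<in> (\<lambda>L e. e \<in> L) ` Pow (edges G)" by blast
  qed
qed (simp add: finite_edges)

lemma reachable_subset:
  assumes "S \<subseteq> nodes G"
  shows "reachable G S \<phi> \<subseteq> nodes G"
proof
  fix v assume "v \<in> reachable G S \<phi>"
  then obtain u where "u \<in> S" "(u, v) \<in> (live_edges G \<phi>)\<^sup>*"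
    by (auto simp: reachable_def)
  from this(2,1) show "v \<in> nodes G"
    by (induction) (use assms edges_subset in \<open>auto simp: live_edges_def\<close>)
qed

lemma observes_partial_realization:
  assumes "\<pi> \<in> policies G" "observes G \<pi> \<phi> \<psi>"
  shows "\<psi> \<in> partial_realizations G"
  using assms(2)
proof induction
  case start
  show ?case by (simp add: partial_realizations_def)
next
  case (select \<psi> u)
  then have "u \<in> nodes G" using assms(1) by (auto simp: policies_def)
  moreover have "dom \<psi> \<subseteq> nodes G" "\<forall>w\<in>dom \<psi>. the (\<psi> w) \<subseteq> {v. (w, v) \<in> edges G}"
    using select.IH by (auto simp: partial_realizations_def)
  ultimately show ?case
    unfolding partial_realizations_def mem_Collect_eq dom_fun_upd by (auto simp: feedback_def)
qed

lemma selected_subset: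
  assumes "\<pi> \<in> policies G"
  shows "selected G \<pi> \<phi> \<subseteq> nodes G"
  using assms observes_partial_realization[OF assms]
  by (force simp: selected_def policies_def)

lemma finite_adaptive_spreads: "finite (adaptive_spread G ` budget_policies G k)"
proof (rule finite_subset)
  let ?R = "set_pmf (realization_pmf G)"
  let ?E = "\<lambda>h. measure_pmf.expectation (realization_pmf G) (\<lambda>\<phi>. real (spread G (h \<phi>) \<phi>))"
  show "adaptive_spread G ` budget_policies G k \<subseteq> ?E ` (?R \<rightarrow>\<^sub>E Pow (nodes G))"
  proof
    fix x assume "x \<in> adaptive_spread G ` budget_policies G k"
    then obtain \<pi> where \<pi>: "\<pi> \<in> policies G" "x = adaptive_spread G \<pi>"
      by (auto simp: budget_policies_def)
    have "x = ?E (restrict (selected G \<pi>) ?R)"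
      unfolding \<pi>(2) adaptive_spread_def
      by (intro integral_cong_AE) (auto simp: AE_measure_pmf_iff)
    moreover have "restrict (selected G \<pi>) ?R \<in> ?R \<rightarrow>\<^sub>E Pow (nodes G)"
      using selected_subset[OF \<pi>(1)] by auto
    ultimately show "x \<in> ?E ` (?R \<rightarrow>\<^sub>E Pow (nodes G))" by blast
  qed
qed (simp add: finite_PiE finite_realizations finite_nodes)

lemma budget_policies_nonempty: "budget_policies G k \<noteq> {}"
proof -
  have "(\<lambda>_. None) \<in> budget_policies G k"
    by (simp add: budget_policies_def policies_def selected_def)
  then show ?thesis by blast
qed

lemma OPT_A_attained: "\<exists>\<pi>\<in>budget_policies G k. OPT_A G k = adaptive_spread G \<pi>"
  using Max_in[OF finite_adaptive_spreads, of k] budget_policies_nonempty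
  unfolding OPT_A_def by auto

lemma finite_seed_sets: "finite {S. S \<subseteq> nodes G \<and> card S \<le> k}"
  using finite_nodes by simp

lemma OPT_N_attained:
  "\<exists>S. S \<subseteq> nodes G \<and> card S \<le> k \<and> OPT_N G k = influence_spread G S"
proof -
  have "{} \<in> {S. S \<subseteq> nodes G \<and> card S \<le> k}" by simp
  then have "influence_spread G ` {S. S \<subseteq> nodes G \<and> card S \<le> k} \<noteq> {}" by blast
  from Max_in[OF _ this] finite_seed_sets show ?thesis
    unfolding OPT_N_def by auto
qed

lemma OPT_N_ge_1:
  assumes "k \<ge> 1"
  shows "OPT_N G k \<ge> 1"
proof -
  obtain v where v: "v \<in> nodes G" using nodes_nonempty by blast
  have "1 \<le> real (spread G {v} \<phi>)" for \<phi>
  proof -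
    have "finite (reachable G {v} \<phi>)"
      using reachable_subset[of "{v}" \<phi>] v finite_nodes finite_subset by auto
    moreover have "v \<in> reachable G {v} \<phi>" by (auto simp: reachable_def)
    ultimately have "0 < card (reachable G {v} \<phi>)" using card_gt_0_iff by blast
    then show ?thesis by (simp add: spread_def)
  qed
  then have "influence_spread G {v} \<ge> 1"
    unfolding influence_spread_def
    by (intro measure_pmf.integral_ge_const integrable_measure_pmf_finite finite_realizations) auto
  moreover have "influence_spread G {v} \<le> OPT_N G k"
    unfolding OPT_N_def using finite_seed_sets v assms by (intro Max_ge) auto
  ultimately show ?thesis by linarith
qed

end

end

(*
  Let S be the random set of seeds chosen by a policy under the realization phi, and let phi' be an
  independent realization. The out-going edges of non-seeds are never observed, so they may be
  taken from phi'; hence the spread of the policy is at most E[sigma(S + N(S, phi))], where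
  N(S, phi) are the heads of the live out-going edges of S. As sigma is monotone and submodular,
  taking these heads from phi' instead of phi loses at most a factor 2. For a fixed set S,
  E[sigma(S + N(S, phi'))] <= 2 sigma(S), because a path from S + N(S, phi') either meets S or avoids
  the out-going edges of S. Hence E[sigma(S)], an average of non-adaptive spreads, is at least a
  quarter of the adaptive spread.
*)
theory Submission
  imports Defs
begin

section \<open>Exchanging coordinates of two independent samples\<close>

text \<open>Fubini for finite supports: both sides are the same finite double sum.\<close>

lemma expectation_pair_pmf_finite:
  fixes h :: "'a \<Rightarrow> 'b \<Rightarrow> real"
  assumes "finite (set_pmf M)" "finite (set_pmf N)"
  shows "measure_pmf.expectation (pair_pmf M N) (\<lambda>(x, y). h x y) =
    measure_pmf.expectation M (\<lambda>x. measure_pmf.expectation N (h x))"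
proof -
  have "measure_pmf.expectation (pair_pmf M N) (\<lambda>(x, y). h x y) =
      (\<Sum>z\<in>set_pmf M \<times> set_pmf N. (case z of (x, y) \<Rightarrow> h x y) * pmf (pair_pmf M N) z)"
    using assms by (intro integral_measure_pmf_real) auto
  also have "\<dots> = (\<Sum>x\<in>set_pmf M. \<Sum>y\<in>set_pmf N. h x y * (pmf M x * pmf N y))"
    by (auto simp: sum.cartesian_product pmf_pair intro!: sum.cong)
  also have "\<dots> = (\<Sum>x\<in>set_pmf M. (\<Sum>y\<in>set_pmf N. h x y * pmf N y) * pmf M x)"
    by (simp add: sum_distrib_left mult_ac)
  also have "\<dots> = (\<Sum>x\<in>set_pmf M. measure_pmf.expectation N (h x) * pmf M x)"
    using assms by (subst integral_measure_pmf_real[of "set_pmf N"]) auto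
  also have "\<dots> = measure_pmf.expectation M (\<lambda>x. measure_pmf.expectation N (h x))"
    using assms by (intro integral_measure_pmf_real[symmetric]) auto
  finally show ?thesis .
qed

text \<open>
  The set of exchanged coordinates may depend on the first sample. The exchange is then an
  involution, hence injective, as long as that set is the same before and after it.
\<close>

lemma map_pair_Pi_pmf_exchange:
  fixes W :: "('a \<Rightarrow> 'b) \<Rightarrow> 'a set"
  assumes "finite A" and W: "\<And>f g. W (override_on f g (W f)) = W f"
  shows "map_pmf (\<lambda>(f, g). (override_on f g (W f), override_on g f (W f)))
      (pair_pmf (Pi_pmf A d p) (Pi_pmf A d p)) = pair_pmf (Pi_pmf A d p) (Pi_pmf A d p)"
    (is "map_pmf ?T ?M = ?M")
proof (rule pmf_eqI)
  fix z
  have involution: "?T (?T x) = x" for x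
    by (cases x) (simp add: W, simp add: override_on_def fun_eq_iff)
  then have "inj ?T" by (rule inj_on_inverseI)
  then have "pmf (map_pmf ?T ?M) (?T (?T z)) = pmf ?M (?T z)"
    by (rule pmf_map_inj')
  also have "\<dots> = pmf ?M z"
  proof -
    obtain f g where z: "z = (f, g)" by (cases z)
    let ?f = "override_on f g (W f)" and ?g = "override_on g f (W f)"
    \<comment> \<open>Outside \<open>A\<close> both samples must take the value \<open>d\<close>, a
      condition symmetric in the two samples.\<close>
    have "(\<forall>x. x \<notin> A \<longrightarrow> ?f x = d) \<and> (\<forall>x. x \<notin> A \<longrightarrow> ?g x = d) \<longleftrightarrow>
        (\<forall>x. x \<notin> A \<longrightarrow> f x = d) \<and> (\<forall>x. x \<notin> A \<longrightarrow> g x = d)"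
      by (auto simp: override_on_def)
    \<comment> \<open>At each coordinate the two factors are kept or swapped, as both samples have
      the same marginal \<open>p x\<close> there.\<close>
    moreover have "(\<Prod>x\<in>A. pmf (p x) (?f x)) * (\<Prod>x\<in>A. pmf (p x) (?g x)) =
        (\<Prod>x\<in>A. pmf (p x) (f x)) * (\<Prod>x\<in>A. pmf (p x) (g x))"
      unfolding prod.distrib[symmetric] by (intro prod.cong) (auto simp: override_on_def)
    ultimately show ?thesis
      using \<open>finite A\<close> unfolding z by (auto simp: pmf_pair pmf_Pi)
  qed
  finally show "pmf (map_pmf ?T ?M) z = pmf ?M z"
    unfolding involution .
qed


section \<open>One step of the diffusion\<close>

text \<open>One round of the cascade from \<open>S\<close>, keeping \<open>S\<close> itself. The
  realization is a separate argument because \<open>S\<close> may have been chosen under a different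
  one.\<close>

definition expose :: "'v influence_graph \<Rightarrow> 'v set \<Rightarrow> 'v realization \<Rightarrow> 'v set" where
  "expose G S \<phi> = S \<union> (\<Union>u\<in>S. feedback G \<phi> u)"

lemma expose_empty [simp]: "expose G {} \<phi> = {}"
  by (simp add: expose_def)

lemma expose_Un: "expose G (S \<union> T) \<phi> = expose G S \<phi> \<union> expose G T \<phi>"
  by (auto simp: expose_def)

lemma expose_cong:
  "(\<And>e. fst e \<in> S \<Longrightarrow> \<phi> e = \<phi>' e) \<Longrightarrow> expose G S \<phi> = expose G S \<phi>'"
  by (simp add: expose_def feedback_def)

lemma reachable_Un: "reachable G (A \<union> B) \<phi> = reachable G A \<phi> \<union> reachable G B \<phi>"
  by (auto simp: reachable_def)

lemma reachable_mono: "A \<subseteq> B \<Longrightarrow> reachable G A \<phi> \<subseteq> reachable G B \<phi>"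
  by (auto simp: reachable_def)

lemma seed_reachable: "S \<subseteq> reachable G S \<phi>"
  by (auto simp: reachable_def)

lemma reachable_step:
  "y \<in> reachable G S \<phi> \<Longrightarrow> (y, z) \<in> edges G \<Longrightarrow> \<phi> (y, z) \<Longrightarrow> z \<in> reachable G S \<phi>"
  by (auto simp: reachable_def live_edges_def intro: rtrancl_into_rtrancl)

lemma reachable_induct [consumes 1, case_names seed step]:
  assumes "v \<in> reachable G S \<phi>"
    and "\<And>u. u \<in> S \<Longrightarrow> P u"
    and "\<And>y z. P y \<Longrightarrow> (y, z) \<in> edges G \<Longrightarrow> \<phi> (y, z) \<Longrightarrow> P z"
  shows "P v"
proof -
  obtain u where "u \<in> S" "(u, v) \<in> (live_edges G \<phi>)\<^sup>*"
    using assms(1) by (auto simp: reachable_def)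
  from this(2,1) show ?thesis
    by induction (auto simp: live_edges_def intro: assms)
qed

text \<open>Follow a live path in the combined realization: an edge leaving \<open>S\<close> is live
  in \<open>\<phi>\<close> and ends in the exposed set, and every other edge is live in
  \<open>\<phi>'\<close>.\<close>

lemma reachable_override_subset_expose:
  "reachable G S (override_on \<phi>' \<phi> (S \<times> UNIV)) \<subseteq> reachable G (expose G S \<phi>) \<phi>'"
proof
  fix v assume "v \<in> reachable G S (override_on \<phi>' \<phi> (S \<times> UNIV))"
  then show "v \<in> reachable G (expose G S \<phi>) \<phi>'"
  proof (induction rule: reachable_induct)
    case (seed u)
    then show ?case using seed_reachable by (fastforce simp: expose_def)
  next
    case (step y z)
    show ?case
    proof (cases "y \<in> S")
      case True
      with step have "z \<in> expose G S \<phi>" by (auto simp: expose_def feedback_def)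
      then show ?thesis using seed_reachable by fast
    next
      case False
      with step show ?thesis by (auto intro: reachable_step)
    qed
  qed
qed

text \<open>A path that meets the first set stays in it. A path that never does avoids
  \<open>S\<close>, so its edges are also live in the combined realization, where its start is a
  live head of an edge leaving \<open>S\<close>.\<close>

lemma reachable_expose_subset:
  "reachable G (expose G S \<phi>) \<phi>' \<subseteq>
    reachable G S \<phi>' \<union> reachable G S (override_on \<phi>' \<phi> (S \<times> UNIV))" (is "_ \<subseteq> ?A \<union> ?B")
proof
  fix v assume "v \<in> reachable G (expose G S \<phi>) \<phi>'"
  then show "v \<in> ?A \<union> ?B"
  proof (induction rule: reachable_induct)
    case (seed v)
    then consider "v \<in> S" | u where "u \<in> S" "(u, v) \<in> edges G" "\<phi> (u, v)"
      by (auto simp: expose_def feedback_def)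
    then show ?case
    proof cases
      case 1
      then show ?thesis using seed_reachable[of S G \<phi>'] by blast
    next
      case 2
      then have "v \<in> ?B"
        using seed_reachable[of S G "override_on \<phi>' \<phi> (S \<times> UNIV)"]
        by - (rule reachable_step[of u], auto)
      then show ?thesis ..
    qed
  next
    case (step y z)
    show ?case
    proof (cases "y \<in> ?A")
      case True
      with step show ?thesis by (auto intro: reachable_step)
    next
      case False
      then have "y \<notin> S" using seed_reachable[of S G \<phi>'] by blast
      with False step show ?thesis by (auto intro: reachable_step)
    qed
  qed
qed


section \<open>The course of a policy\<close>

text \<open>Step-indexed form of \<open>observes\<close>, constant once the policy stops; it allows
  induction and sums over the steps.\<close>

primrec run ::
  "'v influence_graph \<Rightarrow> 'v policy \<Rightarrow> 'v realization \<Rightarrow> nat \<Rightarrow> 'v partial_realization" where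
  "run G \<pi> \<phi> 0 = Map.empty"
| "run G \<pi> \<phi> (Suc n) = (case \<pi> (run G \<pi> \<phi> n) of
      None \<Rightarrow> run G \<pi> \<phi> n
    | Some u \<Rightarrow> (run G \<pi> \<phi> n)(u \<mapsto> feedback G \<phi> u))"

abbreviation seeds :: "'v influence_graph \<Rightarrow> 'v policy \<Rightarrow> nat \<Rightarrow> 'v realization \<Rightarrow> 'v set" where
  "seeds G \<pi> n \<phi> \<equiv> dom (run G \<pi> \<phi> n)"

text \<open>A set with at most one element, so that a step at which the policy has stopped needs no
  separate treatment.\<close>

abbreviation next_seed :: "'v influence_graph \<Rightarrow> 'v policy \<Rightarrow> nat \<Rightarrow> 'v realization \<Rightarrow> 'v set" where
  "next_seed G \<pi> n \<phi> \<equiv> set_option (\<pi> (run G \<pi> \<phi> n))"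

lemma seeds_Suc: "seeds G \<pi> (Suc n) \<phi> = seeds G \<pi> n \<phi> \<union> next_seed G \<pi> n \<phi>"
  by (auto split: option.splits)

text \<open>Myopic feedback: the policy has seen nothing but the out-going edges of its seeds, so
  its course cannot depend on any other edge.\<close>

lemma run_cong:
  "(\<And>e. fst e \<in> seeds G \<pi> n \<phi> \<Longrightarrow> \<phi>' e = \<phi> e) \<Longrightarrow> run G \<pi> \<phi>' n = run G \<pi> \<phi> n"
proof (induction n)
  case (Suc n)
  then have "run G \<pi> \<phi>' n = run G \<pi> \<phi> n" unfolding seeds_Suc by blast
  moreover have "feedback G \<phi>' u = feedback G \<phi> u" if "\<pi> (run G \<pi> \<phi> n) = Some u" for u
    using Suc.prems that unfolding feedback_def seeds_Suc by auto
  ultimately show ?case by (auto split: option.splits)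
qed simp

lemma seeds_mono: "m \<le> n \<Longrightarrow> seeds G \<pi> m \<phi> \<subseteq> seeds G \<pi> n \<phi>"
  by (rule lift_Suc_mono_le[of "\<lambda>n. seeds G \<pi> n \<phi>"]) (simp_all only: seeds_Suc Un_upper1)

lemma seedsD: "u \<in> seeds G \<pi> n \<phi> \<Longrightarrow> \<exists>m<n. \<pi> (run G \<pi> \<phi> m) = Some u"
proof (induction n)
  case (Suc n)
  then show ?case unfolding seeds_Suc by (auto simp: less_Suc_eq)
qed simp

lemma observes_run: "observes G \<pi> \<phi> (run G \<pi> \<phi> n)"
  by (induction n) (auto intro: observes.intros split: option.splits)

lemma observes_iff_run: "observes G \<pi> \<phi> \<psi> \<longleftrightarrow> (\<exists>n. \<psi> = run G \<pi> \<phi> n)"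
proof
  assume "observes G \<pi> \<phi> \<psi>"
  then show "\<exists>n. \<psi> = run G \<pi> \<phi> n"
  proof induction
    case start
    show ?case by (rule exI[of _ 0]) simp
  next
    case (select \<psi> u)
    then obtain n where "\<psi> = run G \<pi> \<phi> n" by blast
    with select.hyps(2) have "\<psi>(u \<mapsto> feedback G \<phi> u) = run G \<pi> \<phi> (Suc n)" by simp
    then show ?case ..
  qed
qed (auto intro: observes_run)


context influence_graph
begin

lemma expose_subset: "S \<subseteq> nodes G \<Longrightarrow> expose G S \<phi> \<subseteq> nodes G"
  using edges_subset by (auto simp: expose_def feedback_def)

lemma finite_reachable: "S \<subseteq> nodes G \<Longrightarrow> finite (reachable G S \<phi>)"
  by (rule finite_subset[OF reachable_subset finite_nodes])

lemma seeds_subset: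
  assumes "\<pi> \<in> policies G"
  shows "seeds G \<pi> n \<phi> \<subseteq> nodes G"
  using observes_partial_realization[OF assms observes_run] by (auto simp: partial_realizations_def)

lemma next_seed_subset:
  assumes "\<pi> \<in> policies G"
  shows "next_seed G \<pi> n \<phi> \<subseteq> nodes G - seeds G \<pi> n \<phi>"
  using observes_partial_realization[OF assms observes_run] assms
  by (fastforce simp: policies_def)

text \<open>Each step before stopping adds a new node, so after \<open>card (nodes G)\<close> steps
  no node is left to select.\<close>

lemma run_stops:
  assumes "\<pi> \<in> policies G"
  shows "\<pi> (run G \<pi> \<phi> (card (nodes G))) = None"
proof -
  have "\<pi> (run G \<pi> \<phi> n) = None \<or> card (seeds G \<pi> n \<phi>) = n" for n
  proof (induction n)
    case (Suc n)
    show ?case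
    proof (cases "\<pi> (run G \<pi> \<phi> n)")
      case (Some u)
      have "u \<notin> seeds G \<pi> n \<phi>"
        using next_seed_subset[OF assms, of \<phi> n] Some by auto
      moreover have "finite (seeds G \<pi> n \<phi>)"
        by (rule finite_subset[OF seeds_subset[OF assms] finite_nodes])
      ultimately have "card (seeds G \<pi> (Suc n) \<phi>) = Suc (card (seeds G \<pi> n \<phi>))"
        unfolding seeds_Suc using Some by simp
      then show ?thesis using Suc Some by (simp del: run.simps)
    qed simp
  qed simp
  moreover have ?thesis if "card (seeds G \<pi> (card (nodes G)) \<phi>) = card (nodes G)"
  proof -
    have "seeds G \<pi> (card (nodes G)) \<phi> = nodes G"
      using card_subset_eq[OF finite_nodes seeds_subset[OF assms] that] .
    then show ?thesis
      using next_seed_subset[OF assms, of \<phi> "card (nodes G)"]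
      by (cases "\<pi> (run G \<pi> \<phi> (card (nodes G)))") auto
  qed
  ultimately show ?thesis by blast
qed

text \<open>This gives one horizon that serves all realizations at once.\<close>

lemma selected_eq_seeds:
  assumes "\<pi> \<in> policies G"
  shows "selected G \<pi> \<phi> = seeds G \<pi> (card (nodes G)) \<phi>"
proof -
  let ?N = "card (nodes G)"
  have "run G \<pi> \<phi> (?N + j) = run G \<pi> \<phi> ?N" for j
    by (induction j) (auto simp: run_stops[OF assms])
  then have stop: "\<pi> (run G \<pi> \<phi> m) = None" if "m \<ge> ?N" for m
    using that run_stops[OF assms] by (metis le_add_diff_inverse)
  have "u \<in> seeds G \<pi> ?N \<phi>" if "\<pi> (run G \<pi> \<phi> m) = Some u" for m u
  proof -
    have "u \<in> seeds G \<pi> (Suc m) \<phi>" unfolding seeds_Suc using that by simp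
    moreover have "Suc m \<le> ?N" using stop[of m] that by (metis not_less_eq_eq option.distinct(1))
    ultimately show ?thesis by (rule subsetD[OF seeds_mono, rotated])
  qed
  then show ?thesis
    unfolding selected_def observes_iff_run using seedsD[of _ G \<pi> \<phi> ?N] by blast
qed


section \<open>Submodularity of the influence spread\<close>

abbreviation expect :: "('v realization \<Rightarrow> real) \<Rightarrow> real" where
  "expect \<equiv> measure_pmf.expectation (realization_pmf G)"

abbreviation expect2 :: "('v realization \<times> 'v realization \<Rightarrow> real) \<Rightarrow> real" where
  "expect2 \<equiv> measure_pmf.expectation (pair_pmf (realization_pmf G) (realization_pmf G))"

lemma integrable_realization [simp]: "integrable (realization_pmf G) (h :: _ \<Rightarrow> real)"
  by (intro integrable_measure_pmf_finite finite_realizations)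

lemma integrable_realization2 [simp]:
  "integrable (pair_pmf (realization_pmf G) (realization_pmf G)) (h :: _ \<Rightarrow> real)"
  by (intro integrable_measure_pmf_finite) (simp add: finite_realizations)

lemma expect2_eq: "expect2 (\<lambda>(\<phi>, \<phi>'). h \<phi> \<phi>') = expect (\<lambda>\<phi>. expect (h \<phi>))"
  by (intro expectation_pair_pmf_finite finite_realizations)

lemma expect2_fst: "expect2 (\<lambda>(\<phi>, \<phi>'). h \<phi>) = expect h"
  by (simp add: expect2_eq)

text \<open>The pair of realizations has the same law after the exchange. The hypothesis says that
  the choice of \<open>W \<phi>\<close> is unaffected by resampling the edges in
  \<open>W \<phi>\<close>.\<close>

lemma expect2_exchange:
  assumes "\<And>\<phi> \<phi>'. W (override_on \<phi> \<phi>' (W \<phi>)) = W \<phi>"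
  shows "expect2 (\<lambda>(\<phi>, \<phi>'). h \<phi> \<phi>') =
    expect2 (\<lambda>(\<phi>, \<phi>'). h (override_on \<phi> \<phi>' (W \<phi>)) (override_on \<phi>' \<phi> (W \<phi>)))"
proof -
  let ?T = "\<lambda>(\<phi>, \<phi>'). (override_on \<phi> \<phi>' (W \<phi>), override_on \<phi>' \<phi> (W \<phi>))"
  let ?P = "pair_pmf (realization_pmf G) (realization_pmf G)"
  have map: "map_pmf ?T ?P = ?P"
    unfolding realization_pmf_def
    using finite_edges assms by (rule map_pair_Pi_pmf_exchange[where W = W])
  have "expect2 (\<lambda>(\<phi>, \<phi>'). h \<phi> \<phi>') =
      measure_pmf.expectation (map_pmf ?T ?P) (\<lambda>(\<phi>, \<phi>'). h \<phi> \<phi>')"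
    unfolding map ..
  also have "\<dots> = expect2 (\<lambda>z. case ?T z of (\<phi>, \<phi>') \<Rightarrow> h \<phi> \<phi>')"
    by (rule integral_map_pmf[where g = ?T])
  also have "(\<lambda>z. case ?T z of (\<phi>, \<phi>') \<Rightarrow> h \<phi> \<phi>') =
      (\<lambda>(\<phi>, \<phi>'). h (override_on \<phi> \<phi>' (W \<phi>)) (override_on \<phi>' \<phi> (W \<phi>)))"
    by (intro ext) (simp split: prod.split)
  finally show ?thesis .
qed

section \<open>Coverage properties of the spread\<close>

lemma spread_mono:
  "A \<subseteq> B \<Longrightarrow> B \<subseteq> nodes G \<Longrightarrow> spread G A \<phi> \<le> spread G B \<phi>"
  unfolding spread_def by (intro card_mono finite_reachable reachable_mono)

text \<open>For a fixed realization the spread is a coverage function: what \<open>C\<close> reaches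
  beyond \<open>B\<close> it also reaches beyond \<open>A\<close>.\<close>

lemma spread_submodular:
  assumes "A \<subseteq> B" "B \<subseteq> nodes G" "C \<subseteq> nodes G"
  shows "spread G (B \<union> C) \<phi> + spread G A \<phi> \<le> spread G B \<phi> + spread G (A \<union> C) \<phi>"
proof -
  let ?r = "\<lambda>S. reachable G S \<phi>"
  have fin: "finite (?r A)" "finite (?r B)" "finite (?r C)"
    using assms by (auto intro!: finite_reachable)
  have "card (?r X \<union> ?r C) = card (?r X) + card (?r C - ?r X)" if "finite (?r X)" for X
    using card_Un_disjoint[of "?r X" "?r C - ?r X"] that fin by auto
  moreover have "card (?r C - ?r B) \<le> card (?r C - ?r A)"
    using reachable_mono[OF assms(1)] fin by (intro card_mono) auto
  ultimately show ?thesis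
    using fin by (simp add: spread_def reachable_Un)
qed

lemma influence_spread_mono:
  "A \<subseteq> B \<Longrightarrow> B \<subseteq> nodes G \<Longrightarrow> influence_spread G A \<le> influence_spread G B"
  unfolding influence_spread_def by (intro integral_mono) (auto intro: spread_mono)

lemma influence_spread_submodular:
  assumes "A \<subseteq> B" "B \<subseteq> nodes G" "C \<subseteq> nodes G"
  shows "influence_spread G (B \<union> C) + influence_spread G A \<le>
    influence_spread G B + influence_spread G (A \<union> C)"
proof -
  have "expect (\<lambda>\<phi>. real (spread G (B \<union> C) \<phi>) + real (spread G A \<phi>)) \<le>
      expect (\<lambda>\<phi>. real (spread G B \<phi>) + real (spread G (A \<union> C) \<phi>))"
    using spread_submodular[OF assms] by (intro integral_mono) (auto simp flip: of_nat_add)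
  then show ?thesis by (simp add: influence_spread_def)
qed

lemma influence_spread_empty: "influence_spread G {} = 0"
  by (simp add: influence_spread_def spread_def reachable_def)


section \<open>The adaptivity gap\<close>

lemma adaptive_spread_le_expose:
  assumes "\<pi> \<in> policies G"
  shows "adaptive_spread G \<pi> \<le>
    expect (\<lambda>\<phi>. influence_spread G (expose G (seeds G \<pi> (card (nodes G)) \<phi>) \<phi>))"
proof -
  let ?S = "seeds G \<pi> (card (nodes G))"
  \<comment> \<open>The exchanged edges are those that leave no seed. The policy never observes
    them, so the exchange preserves the seeds.\<close>
  let ?W = "\<lambda>\<phi>. - (?S \<phi> \<times> UNIV)"
  have "run G \<pi> (override_on \<phi> \<phi>' (?W \<phi>)) (card (nodes G)) = run G \<pi> \<phi> (card (nodes G))"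
    for \<phi> \<phi>'
    by (rule run_cong) (simp add: override_on_def mem_Times_iff)
  then have S: "?S (override_on \<phi> \<phi>' (?W \<phi>)) = ?S \<phi>" for \<phi> \<phi>'
    by (rule arg_cong)
  have W: "override_on \<phi> \<phi>' (?W \<phi>) = override_on \<phi>' \<phi> (?S \<phi> \<times> UNIV)" for \<phi> \<phi>'
    by (auto simp: override_on_def fun_eq_iff)
  have "adaptive_spread G \<pi> = expect2 (\<lambda>(\<phi>, \<phi>'). real (spread G (?S \<phi>) \<phi>))"
    unfolding adaptive_spread_def selected_eq_seeds[OF assms] expect2_fst ..
  also have "\<dots> = expect2 (\<lambda>(\<phi>, \<phi>').
      real (spread G (?S (override_on \<phi> \<phi>' (?W \<phi>))) (override_on \<phi> \<phi>' (?W \<phi>))))"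
    by (rule expect2_exchange) (simp only: S)
  also have "\<dots> = expect2 (\<lambda>(\<phi>, \<phi>'). real (spread G (?S \<phi>) (override_on \<phi>' \<phi> (?S \<phi> \<times> UNIV))))"
    unfolding S unfolding W ..
  also have "\<dots> \<le> expect2 (\<lambda>(\<phi>, \<phi>'). real (spread G (expose G (?S \<phi>) \<phi>) \<phi>'))"
    by (intro integral_mono)
      (auto simp: spread_def intro!: card_mono finite_reachable expose_subset
        reachable_override_subset_expose seeds_subset[OF assms])
  finally show ?thesis
    unfolding expect2_eq influence_spread_def .
qed

text \<open>
  The seeds chosen by the policy are exposed either in the realization that the policy observes or
  in an independent one. Seed by seed, the marginal gain of both exposures together is compared
  with gains over the independent exposures of the earlier seeds; exchanging the out-going edges of
  the current seed shows that both of these gains have the same expectation.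
\<close>

lemma expect_expose_le:
  fixes g :: "'v set \<Rightarrow> real"
  assumes \<pi>: "\<pi> \<in> policies G"
    and mono: "\<And>A B. A \<subseteq> B \<Longrightarrow> B \<subseteq> nodes G \<Longrightarrow> g A \<le> g B"
    and submodular: "\<And>A B C. A \<subseteq> B \<Longrightarrow> B \<subseteq> nodes G \<Longrightarrow> C \<subseteq> nodes G \<Longrightarrow>
      g (B \<union> C) + g A \<le> g B + g (A \<union> C)"
    and "g {} \<ge> 0"
  shows "expect (\<lambda>\<phi>. g (expose G (seeds G \<pi> n \<phi>) \<phi>)) \<le>
    2 * expect2 (\<lambda>(\<phi>, \<phi>'). g (expose G (seeds G \<pi> n \<phi>) \<phi>'))"
proof -
  \<comment> \<open>In both abbreviations the first realization drives the policy and the second one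
    exposes the seeds.\<close>
  let ?A = "\<lambda>i \<phi> \<phi>'. expose G (seeds G \<pi> i \<phi>) \<phi>'"
  let ?R = "\<lambda>i \<phi> \<phi>'. expose G (next_seed G \<pi> i \<phi>) \<phi>'"
  have A_Suc: "?A (Suc i) \<phi> \<phi>' = ?A i \<phi> \<phi>' \<union> ?R i \<phi> \<phi>'" for i \<phi> \<phi>'
    unfolding seeds_Suc expose_Un ..
  have A_nodes: "?A i \<phi> \<phi>' \<subseteq> nodes G" for i \<phi> \<phi>'
    by (intro expose_subset seeds_subset[OF \<pi>])
  have R_nodes: "?R i \<phi> \<phi>' \<subseteq> nodes G" for i \<phi> \<phi>'
    using next_seed_subset[OF \<pi>] by (intro expose_subset) blast
  \<comment> \<open>By submodularity, each of the two exposures of a new seed gains at most what it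
    would gain over \<open>?A i \<phi> \<phi>'\<close> alone. The gains from the exposures in
    \<open>\<phi>'\<close> add up to the last term.\<close>
  have telescope: "g (?A i \<phi> \<phi>' \<union> ?A i \<phi> \<phi>) \<le>
      (\<Sum>j<i. g (?A j \<phi> \<phi>' \<union> ?R j \<phi> \<phi>) - g (?A j \<phi> \<phi>')) + g (?A i \<phi> \<phi>')" for i \<phi> \<phi>'
  proof (induction i)
    case (Suc i)
    let ?X = "?A i \<phi> \<phi>' \<union> ?A i \<phi> \<phi>"
    have "g ((?X \<union> ?R i \<phi> \<phi>') \<union> ?R i \<phi> \<phi>) + g (?A i \<phi> \<phi>') \<le>
        g (?X \<union> ?R i \<phi> \<phi>') + g (?A i \<phi> \<phi>' \<union> ?R i \<phi> \<phi>)"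
      using A_nodes R_nodes by (intro submodular Un_least) auto
    moreover have "g (?X \<union> ?R i \<phi> \<phi>') + g (?A i \<phi> \<phi>') \<le>
        g ?X + g (?A i \<phi> \<phi>' \<union> ?R i \<phi> \<phi>')"
      using A_nodes R_nodes by (intro submodular Un_least) auto
    moreover have "?A (Suc i) \<phi> \<phi>' \<union> ?A (Suc i) \<phi> \<phi> = (?X \<union> ?R i \<phi> \<phi>') \<union> ?R i \<phi> \<phi>"
      unfolding A_Suc by blast
    ultimately show ?case
      unfolding sum.lessThan_Suc using Suc.IH A_Suc[of \<phi> i \<phi>'] by simp
  qed simp
  have exchange: "expect2 (\<lambda>(\<phi>, \<phi>'). g (?A i \<phi> \<phi>' \<union> ?R i \<phi> \<phi>)) =
      expect2 (\<lambda>(\<phi>, \<phi>'). g (?A (Suc i) \<phi> \<phi>'))" for i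
  proof -
    \<comment> \<open>The next seed is new, so its out-going edges affect neither the run so far nor
      the exposure of earlier seeds; exchanging them only moves the exposure of this seed from
      \<open>\<phi>\<close> to \<open>\<phi>'\<close>.\<close>
    let ?W = "\<lambda>\<phi>. next_seed G \<pi> i \<phi> \<times> (UNIV :: 'v set)"
    have run: "run G \<pi> (override_on \<phi> \<phi>' (?W \<phi>)) i = run G \<pi> \<phi> i" for \<phi> \<phi>'
      using next_seed_subset[OF \<pi>, of \<phi> i] by (intro run_cong) (auto simp: override_on_def)
    have A: "expose G (seeds G \<pi> i \<phi>) (override_on \<phi>' \<phi> (?W \<phi>)) = ?A i \<phi> \<phi>'" for \<phi> \<phi>'
      using next_seed_subset[OF \<pi>, of \<phi> i] by (intro expose_cong) (auto simp: override_on_def)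
    have R: "expose G (next_seed G \<pi> i \<phi>) (override_on \<phi> \<phi>' (?W \<phi>)) = ?R i \<phi> \<phi>'" for \<phi> \<phi>'
      by (intro expose_cong) (auto simp: override_on_def)
    show ?thesis
      by (subst expect2_exchange[where W = ?W]) (simp_all only: run A R A_Suc)
  qed
  have "expect (\<lambda>\<phi>. g (?A n \<phi> \<phi>)) = expect2 (\<lambda>(\<phi>, \<phi>'). g (?A n \<phi> \<phi>))"
    by (rule expect2_fst[symmetric])
  also have "\<dots> \<le> expect2 (\<lambda>z. (\<Sum>j<n. (case z of (\<phi>, \<phi>') \<Rightarrow> g (?A j \<phi> \<phi>' \<union> ?R j \<phi> \<phi>)) -
      (case z of (\<phi>, \<phi>') \<Rightarrow> g (?A j \<phi> \<phi>'))) + (case z of (\<phi>, \<phi>') \<Rightarrow> g (?A n \<phi> \<phi>')))"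
  proof (intro integral_mono integrable_realization2)
    fix z :: "'v realization \<times> 'v realization"
    obtain \<phi> \<phi>' where z: "z = (\<phi>, \<phi>')" by (cases z)
    have "g (?A n \<phi> \<phi>) \<le> g (?A n \<phi> \<phi>' \<union> ?A n \<phi> \<phi>)"
      using A_nodes by (intro mono) auto
    from order_trans[OF this telescope]
    show "(case z of (\<phi>, \<phi>') \<Rightarrow> g (?A n \<phi> \<phi>)) \<le>
        (\<Sum>j<n. (case z of (\<phi>, \<phi>') \<Rightarrow> g (?A j \<phi> \<phi>' \<union> ?R j \<phi> \<phi>)) -
          (case z of (\<phi>, \<phi>') \<Rightarrow> g (?A j \<phi> \<phi>'))) + (case z of (\<phi>, \<phi>') \<Rightarrow> g (?A n \<phi> \<phi>'))"
      unfolding z prod.case .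
  qed
  also have "\<dots> = (\<Sum>j<n. expect2 (\<lambda>(\<phi>, \<phi>'). g (?A (Suc j) \<phi> \<phi>')) -
      expect2 (\<lambda>(\<phi>, \<phi>'). g (?A j \<phi> \<phi>'))) + expect2 (\<lambda>(\<phi>, \<phi>'). g (?A n \<phi> \<phi>'))"
    by (simp only: exchange Bochner_Integration.integral_add Bochner_Integration.integral_sum
      Bochner_Integration.integral_diff integrable_realization2)
  \<comment> \<open>The sum telescopes to a second copy of the last term, minus the value at
    \<open>{}\<close>; this is the source of the factor 2.\<close>
  also have "\<dots> = 2 * expect2 (\<lambda>(\<phi>, \<phi>'). g (?A n \<phi> \<phi>')) - g {}"
    unfolding sum_lessThan_telescope[of "\<lambda>j. expect2 (\<lambda>(\<phi>, \<phi>'). g (?A j \<phi> \<phi>'))"]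
    by (simp add: case_prod_unfold)
  finally show ?thesis using \<open>g {} \<ge> 0\<close> by simp
qed

text \<open>The nodes reached are covered by two sets, those reached from \<open>S\<close> in
  \<open>\<phi>'\<close> and those reached from \<open>S\<close> in a combination of both
  realizations. The combination is itself distributed like a single realization, so each set
  contributes one \<open>influence_spread G S\<close>.\<close>

lemma expect_influence_spread_expose_le:
  assumes "S \<subseteq> nodes G"
  shows "expect (\<lambda>\<phi>. influence_spread G (expose G S \<phi>)) \<le> 2 * influence_spread G S"
proof -
  have "expect (\<lambda>\<phi>. influence_spread G (expose G S \<phi>)) =
      expect2 (\<lambda>(\<phi>, \<phi>'). real (spread G (expose G S \<phi>) \<phi>'))"
    unfolding expect2_eq influence_spread_def ..
  also have "\<dots> \<le> expect2 (\<lambda>z. (case z of (\<phi>, \<phi>') \<Rightarrow> real (spread G S \<phi>')) +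
      (case z of (\<phi>, \<phi>') \<Rightarrow> real (spread G S (override_on \<phi> \<phi>' (- (S \<times> UNIV))))))"
  proof (intro integral_mono integrable_realization2)
    fix z :: "'v realization \<times> 'v realization"
    obtain \<phi> \<phi>' where z: "z = (\<phi>, \<phi>')" by (cases z)
    \<comment> \<open>The left side has the form produced by an exchange with a constant set of
      edges; the right side is the form of the covering.\<close>
    have W: "override_on \<phi> \<phi>' (- (S \<times> UNIV)) = override_on \<phi>' \<phi> (S \<times> UNIV)"
      by (auto simp: override_on_def fun_eq_iff)
    have "spread G (expose G S \<phi>) \<phi>' \<le>
        card (reachable G S \<phi>' \<union> reachable G S (override_on \<phi>' \<phi> (S \<times> UNIV)))"
      unfolding spread_def
      by (intro card_mono reachable_expose_subset finite_UnI finite_reachable assms)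
    also have "\<dots> \<le> spread G S \<phi>' + spread G S (override_on \<phi>' \<phi> (S \<times> UNIV))"
      unfolding spread_def by (rule card_Un_le)
    finally show "(case z of (\<phi>, \<phi>') \<Rightarrow> real (spread G (expose G S \<phi>) \<phi>')) \<le>
        (case z of (\<phi>, \<phi>') \<Rightarrow> real (spread G S \<phi>')) +
        (case z of (\<phi>, \<phi>') \<Rightarrow> real (spread G S (override_on \<phi> \<phi>' (- (S \<times> UNIV)))))"
      unfolding z W prod.case by linarith
  qed
  also have "\<dots> = influence_spread G S + expect2 (\<lambda>(\<phi>, \<phi>').
      real (spread G S (override_on \<phi> \<phi>' (- (S \<times> UNIV)))))"
    by (simp add: expect2_eq influence_spread_def)
  also have "expect2 (\<lambda>(\<phi>, \<phi>'). real (spread G S (override_on \<phi> \<phi>' (- (S \<times> UNIV))))) =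
      expect2 (\<lambda>(\<phi>, \<phi>'). real (spread G S \<phi>))"
    by (rule expect2_exchange[symmetric]) simp
  also have "\<dots> = influence_spread G S"
    unfolding expect2_fst influence_spread_def ..
  finally show ?thesis by simp
qed

text \<open>One factor 2 pays for exposing the seeds in an independent realization, the other for
  dropping that exposure. Under each \<open>\<phi>\<close> the seeds form a set of at most
  \<open>k\<close> nodes, which competes in \<open>OPT_N G k\<close>.\<close>

lemma OPT_A_le: "OPT_A G k \<le> 4 * OPT_N G k"
proof -
  obtain \<pi> where \<pi>: "\<pi> \<in> budget_policies G k" and OPT: "OPT_A G k = adaptive_spread G \<pi>"
    using OPT_A_attained by blast
  let ?S = "seeds G \<pi> (card (nodes G))"
  have policy: "\<pi> \<in> policies G" and card: "card (?S \<phi>) \<le> k" for \<phi>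
    using \<pi> selected_eq_seeds by (auto simp: budget_policies_def)
  have "adaptive_spread G \<pi> \<le> expect (\<lambda>\<phi>. influence_spread G (expose G (?S \<phi>) \<phi>))"
    using policy by (rule adaptive_spread_le_expose)
  also have "\<dots> \<le> 2 * expect2 (\<lambda>(\<phi>, \<phi>'). influence_spread G (expose G (?S \<phi>) \<phi>'))"
    using policy influence_spread_mono influence_spread_submodular
    by (rule expect_expose_le) (simp_all add: influence_spread_empty)
  also have "\<dots> = 2 * expect (\<lambda>\<phi>. expect (\<lambda>\<phi>'. influence_spread G (expose G (?S \<phi>) \<phi>')))"
    unfolding expect2_eq ..
  also have "\<dots> \<le> 2 * expect (\<lambda>\<phi>. 2 * OPT_N G k)"
  proof (intro mult_left_mono integral_mono integrable_realization)
    fix \<phi>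
    have "influence_spread G (?S \<phi>) \<le> OPT_N G k"
      unfolding OPT_N_def using finite_seed_sets seeds_subset[OF policy] card by (intro Max_ge) auto
    with expect_influence_spread_expose_le[OF seeds_subset[OF policy], of \<phi> "card (nodes G)"]
    show "expect (\<lambda>\<phi>'. influence_spread G (expose G (?S \<phi>) \<phi>')) \<le> 2 * OPT_N G k"
      by linarith
  qed simp
  finally show ?thesis using OPT by simp
qed

end

theorem theorem1:
  "(SUP (G :: 'v influence_graph, k) \<in> {(G, k). influence_graph G \<and> k \<ge> 1}.
      ereal (OPT_A G k / OPT_N G k)) \<le> 4"
proof (rule SUP_least, clarify)
  fix G :: "'v influence_graph" and k :: nat
  assume "influence_graph G" "1 \<le> k"
  then interpret influence_graph G by simp
  \<comment> \<open>The budget \<open>k \<ge> 1\<close> makes the denominator positive.\<close>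
  have "OPT_A G k / OPT_N G k \<le> 4"
    using OPT_A_le[of k] OPT_N_ge_1[OF \<open>1 \<le> k\<close>] by (simp add: divide_le_eq)
  then show "ereal (OPT_A G k / OPT_N G k) \<le> 4" by simp
qed

end
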